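(* Let $p>1$, and let $$X(t)=X(0)+at+\sum_{i=0}^\infty\sum_{j\in J_i}\theta_{i,j}e_{i,j}(t),\qquad t\in[0,T],$$ be a random Faber–Schauder expansion (with real random variables $X(0)$, $a$, $\theta_{i,j}$ on a common probability space), where each $J_i$ is finite and the series converges uniformly almost surely. Define the tail $\sigma$-field $$\mathcal F_\infty:=\bigcap_{n\ge1}\mathcal F_n,\qquad\mathcal F_n:=\sigma(\theta_{i,j}:i\ge n,\ j\in J_i).$$ Then the event $\{X\in\mathscr R_p([0,T])\}$ agrees almost surely with an event in $\mathcal F_\infty$. Thus changing finitely many coefficient levels does not affect the $p$-roughness property. If the random vectors $(\theta_{i,j})_{j\in J_i}$ are independent across levels $i$, then $$\mathbb P\bigl(X\in\mathscr R_p([0,T])\bigr)\in\{0,1\}.$$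
   Context: $p$-roughness: for a finite partition $\lambda=\{0=u_0<\dots<u_N=T\}$ put $\mathsf V^p_\lambda(x;t):=\sum_i|x(u_{i+1}\wedge t)-x(u_i\wedge t)|^p$; for $0<\ell\le T$, $0\le s<\ell$ put $\Pi(\ell,s):=\{0,T\}\cup\{s+k\ell:k\in\mathbb Z,\ 0<s+k\ell<T\}$. $\mathscr R_p([0,T])$ is the set of $x\in C([0,T];\mathbb R)$ for which there is a continuous nondecreasing $A:[0,T]\to[0,\infty)$ with $A(T)>A(0)=0$ such that $\sup_{0<\ell\le\delta}\sup_{0\le s<\ell}\sup_{t\in[0,T]}|\mathsf V^p_{\Pi(\ell,s)}(x;t)-A(t)|\to0$ as $\delta\downarrow0$. Faber–Schauder functions: $(e_{i,j})_{i\ge0,\,j\in J_i}$ is the (deterministic) Faber–Schauder system of a finitely refining sequence of nested partitions $\pi_0\subset\pi_1\subset\cdots$ of $[0,T]$ with vanishing mesh, each cell of $\pi_i$ being subdivided by $\pi_{i+1}$ into a bounded number of cells. For each cell of $\pi_i$ subdivided by $\pi_{i+1}$ at $s_0<s_1<\dots<s_r$ and each $1\le l\le r-1$, the level-$i$ Haar function is constant and positive on $[s_0,s_l)$, constant and negative on $[s_l,s_{l+1})$, zero elsewhere, has zero integral and unit $L^2$ norm; the level-$i$ Schauder functions $e_{i,j}$ are the primitives $\int_0^t$ of these Haar functions. In particular each $e_{i,j}$ is a continuous piecewise linear tent function on $[0,T]$. The basic example (with $T=1$) is the dyadic system $e_{i,j}(t)=2^{-i/2}\varphi(2^it-j)$,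 $0\le j<2^i$, $\varphi(u)=\max\{0,\min\{u,1-u\}\}$. *)

theory Defs
  imports "HOL-Probability.Probability"
begin

text \<open>Functions on \<open>[0,T]\<close> are represented by functions \<open>real \<Rightarrow> real\<close> whose values outside
  \<open>{0..T}\<close> are irrelevant. A partition is represented by the finite set of its points.\<close>

definition is_partition :: "real \<Rightarrow> real set \<Rightarrow> bool" where
  "is_partition T P \<longleftrightarrow> finite P \<and> {0, T} \<subseteq> P \<and> P \<subseteq> {0..T}"

text \<open>The pairs of consecutive points \<open>u\<^sub>i, u\<^sub>i\<^sub>+\<^sub>1\<close> of a finite set.\<close>

definition cells :: "real set \<Rightarrow> (real \<times> real) set" where
  "cells P = {(u, v). u \<in> P \<and> v \<in> P \<and> u < v \<and> P \<inter> {u<..<v} = {}}"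

definition mesh :: "real set \<Rightarrow> real" where
  "mesh P = Max ((\<lambda>(u, v). v - u) ` cells P)"


subsection \<open>\<open>p\<close>-roughness\<close>

definition pvar :: "real \<Rightarrow> real set \<Rightarrow> (real \<Rightarrow> real) \<Rightarrow> real \<Rightarrow> real" where
  "pvar p P x t = (\<Sum>(u, v)\<in>cells P. \<bar>x (min v t) - x (min u t)\<bar> powr p)"

definition shifted_grid :: "real \<Rightarrow> real \<Rightarrow> real \<Rightarrow> real set" where
  "shifted_grid T l s =
     {0, T} \<union> {s + of_int k * l | k :: int. 0 < s + of_int k * l \<and> s + of_int k * l < T}"

text \<open>The suprema are taken in the extended reals, so that they are meaningful without any
  boundedness condition. The restriction \<open>l \<le> T\<close> is immaterial in the limit \<open>\<delta> \<down> 0\<close>.\<close>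

definition rough :: "real \<Rightarrow> real \<Rightarrow> (real \<Rightarrow> real) set" where
  "rough p T = {x. continuous_on {0..T} x \<and>
     (\<exists>A :: real \<Rightarrow> real. continuous_on {0..T} A \<and> mono_on {0..T} A \<and> (\<forall>t\<in>{0..T}. 0 \<le> A t) \<and>
        A 0 = 0 \<and> A T > A 0 \<and>
        ((\<lambda>\<delta>. SUP l\<in>{0<..\<delta>}. SUP s\<in>{0..<l}. SUP t\<in>{0..T}.
            ereal \<bar>pvar p (shifted_grid T l s) x t - A t\<bar>) \<longlongrightarrow> 0) (at_right 0))}"


subsection \<open>Faber--Schauder systems\<close>

definition finitely_refining :: "real \<Rightarrow> (nat \<Rightarrow> real set) \<Rightarrow> bool" where
  "finitely_refining T \<pi> \<longleftrightarrow>
     (\<forall>i. is_partition T (\<pi> i)) \<and> (\<forall>i. \<pi> i \<subseteq> \<pi> (Suc i)) \<and> (\<lambda>i. mesh (\<pi> i)) \<longlonglongrightarrow> 0 \<and>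
     (\<exists>K :: nat. \<forall>i. \<forall>(u, v)\<in>cells (\<pi> i). card (cells (\<pi> (Suc i) \<inter> {u..v})) \<le> K)"

text \<open>The list \<open>[s\<^sub>0, \<dots>, s\<^sub>r]\<close> of the points at which the next partition \<open>Q\<close> subdivides
  the cell \<open>(u, v)\<close>, so \<open>s\<^sub>0 = u\<close> and \<open>s\<^sub>r = v\<close>.\<close>

definition subdivision :: "real set \<Rightarrow> real \<times> real \<Rightarrow> real list" where
  "subdivision Q = (\<lambda>(u, v). sorted_list_of_set (Q \<inter> {u..v}))"

text \<open>The level-\<open>i\<close> positions: a cell of \<open>\<pi> i\<close> together with an index \<open>l\<close> such that
  \<open>1 \<le> l \<le> r - 1\<close>, where \<open>r + 1\<close> is the length of the subdivision.\<close>

definition haar_positions :: "(nat \<Rightarrow> real set) \<Rightarrow> nat \<Rightarrow> ((real \<times> real) \<times> nat) set" where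
  "haar_positions \<pi> i =
     {(c, l). c \<in> cells (\<pi> i) \<and> 1 \<le> l \<and> Suc l < length (subdivision (\<pi> (Suc i)) c)}"

definition is_haar :: "real \<Rightarrow> real \<Rightarrow> real \<Rightarrow> real \<Rightarrow> (real \<Rightarrow> real) \<Rightarrow> bool" where
  "is_haar T x y z h \<longleftrightarrow>
     (\<exists>\<alpha>>0. \<forall>t\<in>{x..<y}. h t = \<alpha>) \<and> (\<exists>\<beta><0. \<forall>t\<in>{y..<z}. h t = \<beta>) \<and> (\<forall>t. t \<notin> {x..<z} \<longrightarrow> h t = 0) \<and>
     (h has_integral 0) {0..T} \<and> ((\<lambda>t. (h t)\<^sup>2) has_integral 1) {0..T}"

text \<open>The index sets \<open>J i\<close> are abstract: \<open>\<kappa>\<close> enumerates the level-\<open>i\<close> positions by \<open>J i\<close>,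
  each position occurring exactly once.\<close>

definition faber_schauder ::
    "real \<Rightarrow> (nat \<Rightarrow> real set) \<Rightarrow> (nat \<Rightarrow> 'j set) \<Rightarrow> (nat \<Rightarrow> 'j \<Rightarrow> real \<Rightarrow> real) \<Rightarrow> bool" where
  "faber_schauder T \<pi> J e \<longleftrightarrow>
     (\<forall>i. \<exists>\<kappa>. bij_betw \<kappa> (J i) (haar_positions \<pi> i) \<and>
       (\<forall>j\<in>J i. \<forall>c l. \<kappa> j = (c, l) \<longrightarrow>
         (let s = subdivision (\<pi> (Suc i)) c in
          \<exists>h. is_haar T (s ! 0) (s ! l) (s ! Suc l) h \<and>
              (\<forall>t\<in>{0..T}. e i j t = integral {0..t} h))))"

text \<open>\<open>x(t) = x(0) + a t + \<Sum>\<^sub>i \<Sum>\<^sub>j \<theta>\<^sub>i\<^sub>j e\<^sub>i\<^sub>j(t)\<close>, with the series over the levels \<open>i\<close>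
  converging uniformly on \<open>[0,T]\<close>.\<close>

definition fs_expansion ::
    "real \<Rightarrow> (nat \<Rightarrow> 'j set) \<Rightarrow> (nat \<Rightarrow> 'j \<Rightarrow> real \<Rightarrow> real) \<Rightarrow>
     real \<Rightarrow> (nat \<Rightarrow> 'j \<Rightarrow> real) \<Rightarrow> (real \<Rightarrow> real) \<Rightarrow> bool" where
  "fs_expansion T J e a \<theta> x \<longleftrightarrow>
     uniform_limit {0..T}
       (\<lambda>n t. x 0 + a * t + (\<Sum>i<n. \<Sum>j\<in>J i. \<theta> i j * e i j t)) x sequentially"


subsection \<open>The tail \<open>\<sigma>\<close>-field\<close>

definition coeff_field ::
    "'w set \<Rightarrow> (nat \<Rightarrow> 'j set) \<Rightarrow> (nat \<Rightarrow> 'j \<Rightarrow> 'w \<Rightarrow> real) \<Rightarrow> nat \<Rightarrow> 'w set set" where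
  "coeff_field \<Omega> J \<theta> n =
     sigma_sets \<Omega> {\<theta> i j -` B \<inter> \<Omega> | i j B. n \<le> i \<and> j \<in> J i \<and> B \<in> sets borel}"

definition tail_field ::
    "'w set \<Rightarrow> (nat \<Rightarrow> 'j set) \<Rightarrow> (nat \<Rightarrow> 'j \<Rightarrow> 'w \<Rightarrow> real) \<Rightarrow> 'w set set" where
  "tail_field \<Omega> J \<theta> = (\<Inter>n\<in>{1..}. coeff_field \<Omega> J \<theta> n)"

end

theory Submission
  imports Defs
begin

text \<open>Adding a Lipschitz function \<open>g\<close> to \<open>x\<close> does not change the limit of the \<open>p\<close>-th variations along
  shifted grids: for \<open>p > 1\<close> the \<open>p\<close>-th variation of \<open>g\<close> at scale \<open>\<ell>\<close> is at most
  \<open>L\<^sup>p \<ell>\<^sup>p\<^sup>-\<^sup>1 T \<rightarrow> 0\<close>, and \<open>\<bar>\<bar>a + b\<bar>\<^sup>p - \<bar>a\<bar>\<^sup>p\<bar> \<le> \<epsilon> \<bar>a\<bar>\<^sup>p + C\<^sub>\<epsilon> \<bar>b\<bar>\<^sup>p\<close>. Schauder functions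
  are Lipschitz, so roughness of \<open>X\<close> is roughness of the tail series from any level on. Roughness of a
  continuous function amounts to the variations along shifted grids being uniformly Cauchy with nonzero
  limit at \<open>T\<close>, which, by continuity in the grid parameters, is a countable condition; hence it is
  measurable with respect to every coefficient field. Kolmogorov's 0-1 law concludes.\<close>

section \<open>Variation sums along shifted grids\<close>

text \<open>Induction on n: since \<open>q n\<close> is the largest point so far, a strictly larger
  \<open>q (Suc n)\<close> adds exactly one cell, and a repeated value adds none. The latter matches
  the right-hand side because F vanishes on the diagonal.\<close>

lemma sum_cells_image:
  fixes q :: "nat \<Rightarrow> real" and F :: "real \<Rightarrow> real \<Rightarrow> real"
  assumes "mono q" and F: "\<And>u. F u u = 0"
  shows "(\<Sum>(u, v)\<in>cells (q ` {..n}). F u v) = (\<Sum>k<n. F (q k) (q (Suc k)))"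
proof (induction n)
  case 0
  have "cells (q ` {..0}) = {}" by (auto simp: cells_def)
  then show ?case by simp
next
  case (Suc n)
  have le: "w \<le> q n" if "w \<in> q ` {..n}" for w
    using that \<open>mono q\<close> by (auto simp: mono_def)
  have qn: "q n \<in> q ` {..n}" by simp
  have ins: "q ` {..Suc n} = insert (q (Suc n)) (q ` {..n})"
    by (simp add: atMost_Suc)
  have mn: "q n \<le> q (Suc n)" using \<open>mono q\<close> by (simp add: mono_def)
  show ?case
  proof (cases "q n = q (Suc n)")
    case True
    then have "q ` {..Suc n} = q ` {..n}" using ins qn by auto
    then show ?thesis using Suc True F by simp
  next
    case False
    then have lt: "q n < q (Suc n)" using mn by simp
    have "cells (q ` {..Suc n}) = insert (q n, q (Suc n)) (cells (q ` {..n}))"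
      unfolding ins cells_def using le qn lt by (force simp del: image_eqI)
    moreover have "(q n, q (Suc n)) \<notin> cells (q ` {..n})"
      using le lt by (force simp: cells_def)
    moreover have "finite (cells (q ` {..n}))"
      by (rule finite_subset[of _ "q ` {..n} \<times> q ` {..n}"]) (auto simp: cells_def)
    ultimately show ?thesis using Suc by simp
  qed
qed

text \<open>The points \<open>s + (k - 1) l\<close> clamped to \<open>[0,T]\<close>: the degenerate cells do not contribute to
  \<open>pvar\<close>, and the enumeration by \<open>k\<close> depends continuously on \<open>(l, s)\<close>, also where a point enters or
  leaves \<open>[0,T]\<close>.\<close>

definition clamped_grid :: "real \<Rightarrow> real \<Rightarrow> real \<Rightarrow> nat \<Rightarrow> real" where
  "clamped_grid T l s k = max 0 (min T (s + (real k - 1) * l))"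

lemma clamped_grid_mono: "0 \<le> l \<Longrightarrow> mono (clamped_grid T l s)"
  unfolding mono_def clamped_grid_def
  by (intro allI impI max.mono min.mono add_left_mono mult_right_mono) auto

text \<open>The offset \<open>k - 1\<close> places index 0 at \<open>s - l < 0\<close>, which is
  clamped to 0, and the last hypothesis places index \<open>Suc n\<close> at or beyond T, which is
  clamped to T. The grid points strictly between are the unclamped values.\<close>

lemma shifted_grid_eq_clamped_grid:
  assumes "0 < T" "0 \<le> s" "s < l" "T \<le> s + real n * l"
  shows "shifted_grid T l s = clamped_grid T l s ` {..Suc n}"
proof (intro equalityI subsetI)
  fix w assume "w \<in> shifted_grid T l s"
  then consider "w = 0" | "w = T" | k :: int where "w = s + of_int k * l" "0 < w" "w < T"
    by (auto simp: shifted_grid_def)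
  then show "w \<in> clamped_grid T l s ` {..Suc n}"
  proof cases
    case 1
    then show ?thesis using assms by (intro image_eqI[of _ _ 0]) (auto simp: clamped_grid_def)
  next
    case 2
    then show ?thesis using assms by (intro image_eqI[of _ _ "Suc n"]) (auto simp: clamped_grid_def)
  next
    case 3
    have "l > 0" using assms by simp
    have "k \<ge> 0"
    proof (rule ccontr)
      assume "\<not> k \<ge> 0"
      then have "of_int k \<le> (-1 :: real)" by linarith
      then have "of_int k * l \<le> -1 * l" using \<open>l > 0\<close> by (intro mult_right_mono) auto
      then show False using 3 assms by simp
    qed
    have "of_int k * l < real n * l" using 3 assms by linarith
    then have "real_of_int k < real n" using \<open>l > 0\<close> by (rule mult_right_less_imp_less[OF _ less_imp_le])
    then have "k < int n" by linarith
    have "w = clamped_grid T l s (Suc (nat k))"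
      using 3 \<open>k \<ge> 0\<close> by (simp add: clamped_grid_def)
    then show ?thesis using \<open>k < int n\<close> \<open>k \<ge> 0\<close> by (intro image_eqI[of _ _ "Suc (nat k)"]) auto
  qed
next
  fix w assume "w \<in> clamped_grid T l s ` {..Suc n}"
  then obtain k where w: "w = max 0 (min T (s + of_int (int k - 1) * l))"
    by (auto simp: clamped_grid_def)
  show "w \<in> shifted_grid T l s"
  proof (cases "0 < w \<and> w < T")
    case True
    then have "w = s + of_int (int k - 1) * l" unfolding w by (auto simp: max_def min_def split: if_splits)
    then show ?thesis using True unfolding shifted_grid_def by blast
  next
    case False
    then have "w = 0 \<or> w = T" using w \<open>0 < T\<close> by (auto simp: max_def min_def split: if_splits)
    then show ?thesis by (auto simp: shifted_grid_def)
  qed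
qed

lemma shifted_grid_subset: "0 \<le> T \<Longrightarrow> shifted_grid T l s \<subseteq> {0..T}"
  by (auto simp: shifted_grid_def)

lemma pvar_shifted_grid:
  assumes "0 < T" "0 \<le> s" "s < l" "T \<le> s + real n * l"
  shows "pvar p (shifted_grid T l s) x t =
    (\<Sum>k<Suc n. \<bar>x (min (clamped_grid T l s (Suc k)) t) - x (min (clamped_grid T l s k) t)\<bar> powr p)"
  unfolding pvar_def shifted_grid_eq_clamped_grid[OF assms]
  using assms by (intro sum_cells_image clamped_grid_mono) auto

lemma ex_grid_length:
  fixes l T :: real
  assumes "0 < l"
  obtains n where "T \<le> real n * l"
  using reals_Archimedean3[OF assms] less_imp_le by blast

lemma pvar_nonneg: "0 \<le> pvar p P x t"
  unfolding pvar_def by (intro sum_nonneg) auto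

lemma pvar_cong:
  assumes "P \<subseteq> {0..T}" "t \<in> {0..T}" "\<And>t. t \<in> {0..T} \<Longrightarrow> x t = y t"
  shows "pvar p P x t = pvar p P y t"
  unfolding pvar_def
proof (intro sum.cong refl, clarify)
  fix u v assume "(u, v) \<in> cells P"
  then have "u \<in> {0..T}" "v \<in> {0..T}" using assms(1) by (auto simp: cells_def)
  then have "min u t \<in> {0..T}" "min v t \<in> {0..T}" using assms(2) by auto
  then show "\<bar>x (min v t) - x (min u t)\<bar> powr p = \<bar>y (min v t) - y (min u t)\<bar> powr p"
    using assms(3) by simp
qed

lemma pvar_at_0: "P \<subseteq> {0..T} \<Longrightarrow> pvar p P x 0 = 0"
  unfolding pvar_def
proof (intro sum.neutral, clarify)
  fix u v assume "P \<subseteq> {0..T}" "(u, v) \<in> cells P"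
  then have "min u 0 = 0" "min v 0 = 0" by (auto simp: cells_def)
  then show "\<bar>x (min v 0) - x (min u 0)\<bar> powr p = 0" by simp
qed

text \<open>No cell straddles a grid point u: cells to its left contribute the same at u and at t,
  and cells to its right contribute 0 at u.\<close>

lemma pvar_mono_from_grid_point:
  assumes "u \<in> P" "u \<le> t"
  shows "pvar p P x u \<le> pvar p P x t"
  unfolding pvar_def
proof (intro sum_mono, clarify)
  fix a b assume "(a, b) \<in> cells P"
  then have "b \<le> u \<or> u \<le> a" using assms(1) by (force simp: cells_def)
  then show "\<bar>x (min b u) - x (min a u)\<bar> powr p \<le> \<bar>x (min b t) - x (min a t)\<bar> powr p"
    using assms(2) \<open>(a, b) \<in> cells P\<close> by (auto simp: min_def cells_def)
qed

text \<open>The shift is u reduced modulo l; the endpoints 0 and T lie on every grid. This places a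
  prescribed point on a grid of prescribed spacing, where variations can be compared
  monotonically.\<close>

lemma ex_shift_through_point:
  assumes "0 < l" "u \<in> {0..T}"
  obtains s where "s \<in> {0..<l}" "u \<in> shifted_grid T l s"
proof -
  define s where "s = u - of_int \<lfloor>u / l\<rfloor> * l"
  have "of_int \<lfloor>u / l\<rfloor> \<le> u / l" "u / l < of_int \<lfloor>u / l\<rfloor> + 1" by linarith+
  then have "of_int \<lfloor>u / l\<rfloor> * l \<le> u" "u < (of_int \<lfloor>u / l\<rfloor> + 1) * l"
    using assms(1) by (simp_all only: pos_le_divide_eq pos_divide_less_eq)
  then have "s \<in> {0..<l}" by (simp add: s_def algebra_simps)
  moreover have "u \<in> shifted_grid T l s"
  proof (cases "u = 0 \<or> u = T")
    case False
    moreover have u: "u = s + of_int \<lfloor>u / l\<rfloor> * l" by (simp add: s_def)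
    ultimately have "0 < s + of_int \<lfloor>u / l\<rfloor> * l \<and> s + of_int \<lfloor>u / l\<rfloor> * l < T"
      using assms(2) by auto
    then show ?thesis using u unfolding shifted_grid_def by blast
  qed (auto simp: shifted_grid_def)
  ultimately show thesis by (rule that)
qed

text \<open>As l stays above \<open>\<eta>\<close>, one n covers \<open>[0,T]\<close> for all
  parameters in S. The variation is then a sum of fixed length whose terms are continuous in the
  clamped points, so nothing jumps when a grid point enters or leaves \<open>[0,T]\<close>.\<close>

lemma continuous_on_pvar_shifted_grid:
  assumes x: "continuous_on {0..T} x" and "0 < T" "0 < p"
    and S: "0 < \<eta>" "\<And>l s t. (l, s, t) \<in> S \<Longrightarrow> \<eta> \<le> l \<and> 0 \<le> s \<and> s < l \<and> 0 \<le> t \<and> t \<le> T"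
  shows "continuous_on S (\<lambda>(l, s, t). pvar p (shifted_grid T l s) x t)"
proof -
  obtain n where n: "T \<le> real n * \<eta>" using ex_grid_length[OF S(1)] by blast
  let ?q = "\<lambda>k z. min (clamped_grid T (fst z) (fst (snd z)) k) (snd (snd z))"
  have q: "continuous_on S (\<lambda>z. x (?q k z))" for k
    unfolding clamped_grid_def
    using \<open>0 < T\<close> S(2) by (intro continuous_on_compose2[OF x] continuous_intros) fastforce
  have "continuous_on S (\<lambda>z. \<Sum>k<Suc n. \<bar>x (?q (Suc k) z) - x (?q k z)\<bar> powr p)"
    using \<open>0 < p\<close> by (intro continuous_on_sum continuous_on_powr' continuous_intros q) auto
  moreover have "(case z of (l, s, t) \<Rightarrow> pvar p (shifted_grid T l s) x t) =
      (\<Sum>k<Suc n. \<bar>x (?q (Suc k) z) - x (?q k z)\<bar> powr p)" if "z \<in> S" for z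
  proof -
    obtain l s t where z: "z = (l, s, t)" by (cases z)
    have "real n * \<eta> \<le> real n * l" using S(2) that z by (intro mult_left_mono) auto
    then have "T \<le> s + real n * l" using n S(2)[of l s t] that z by auto
    then show ?thesis using S(2)[of l s t] that z \<open>0 < T\<close> by (simp add: pvar_shifted_grid)
  qed
  ultimately show ?thesis by (subst continuous_on_cong[OF refl]) auto
qed

section \<open>Roughness in epsilon-delta form\<close>

text \<open>The bound on the nested suprema in \<open>rough\<close>, without extended reals. A is an
  arbitrary function here: it stands for the limit function, and in the Cauchy criterion for the
  variation along a reference grid.\<close>

definition pvar_close ::
    "real \<Rightarrow> real \<Rightarrow> (real \<Rightarrow> real) \<Rightarrow> (real \<Rightarrow> real) \<Rightarrow> real \<Rightarrow> real \<Rightarrow> bool" where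
  "pvar_close p T x A \<epsilon> \<delta> \<longleftrightarrow>
     (\<forall>l\<in>{0<..\<delta>}. \<forall>s\<in>{0..<l}. \<forall>t\<in>{0..T}. \<bar>pvar p (shifted_grid T l s) x t - A t\<bar> \<le> \<epsilon>)"

lemma pvar_close_antimono: "pvar_close p T x A \<epsilon> \<delta> \<Longrightarrow> \<delta>' \<le> \<delta> \<Longrightarrow> pvar_close p T x A \<epsilon> \<delta>'"
  by (auto simp: pvar_close_def)

lemma tendsto_SUP_iff_pvar_close:
  assumes "0 < T"
  shows "((\<lambda>\<delta>. SUP l\<in>{0<..\<delta>}. SUP s\<in>{0..<l}. SUP t\<in>{0..T}.
            ereal \<bar>pvar p (shifted_grid T l s) x t - A t\<bar>) \<longlongrightarrow> 0) (at_right 0) \<longleftrightarrow>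
         (\<forall>\<epsilon>>0. \<exists>\<delta>>0. pvar_close p T x A \<epsilon> \<delta>)" (is "(?F \<longlongrightarrow> 0) _ \<longleftrightarrow> _")
proof
  have le: "?F \<delta> \<le> ereal \<epsilon> \<longleftrightarrow> pvar_close p T x A \<epsilon> \<delta>" for \<delta> \<epsilon>
    by (simp add: SUP_le_iff pvar_close_def)
  {
    assume lim: "(?F \<longlongrightarrow> 0) (at_right 0)"
    show "\<forall>\<epsilon>>0. \<exists>\<delta>>0. pvar_close p T x A \<epsilon> \<delta>"
    proof (intro allI impI)
      fix \<epsilon> :: real assume "\<epsilon> > 0"
      then have "\<forall>\<^sub>F \<delta> in at_right 0. ?F \<delta> < ereal \<epsilon>"
        by (intro order_tendstoD(2)[OF lim]) simp
      then obtain b where b: "b > 0" "\<And>\<delta>. 0 < \<delta> \<Longrightarrow> \<delta> < b \<Longrightarrow> ?F \<delta> < ereal \<epsilon>"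
        unfolding eventually_at_right_field by auto
      have "?F (b / 2) \<le> ereal \<epsilon>" using b(1) by (intro less_imp_le b(2)) auto
      then show "\<exists>\<delta>>0. pvar_close p T x A \<epsilon> \<delta>" unfolding le using b(1) by (intro exI[of _ "b / 2"]) auto
    qed
  next
    assume close: "\<forall>\<epsilon>>0. \<exists>\<delta>>0. pvar_close p T x A \<epsilon> \<delta>"
    show "(?F \<longlongrightarrow> 0) (at_right 0)"
    proof (rule order_tendstoI)
      fix c :: ereal assume "c < 0"
      show "\<forall>\<^sub>F \<delta> in at_right 0. c < ?F \<delta>"
      proof (rule eventually_at_rightI[of 0 1])
        fix \<delta> :: real assume "\<delta> \<in> {0<..<1}"
        \<comment> \<open>A supremum over an empty set would be minus infinity, so explicit indices
          are supplied: spacing \<open>\<delta>\<close>, shift 0 and time 0.\<close>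
        have "0 \<le> ?F \<delta>"
          by (rule SUP_upper2[of \<delta>], use \<open>\<delta> \<in> _\<close> in simp,
              rule SUP_upper2[of 0], use \<open>\<delta> \<in> _\<close> in simp,
              rule SUP_upper2[of 0], use \<open>0 < T\<close> in simp, simp)
        with \<open>c < 0\<close> show "c < ?F \<delta>" by simp
      qed simp
    next
      fix c :: ereal assume "0 < c"
      then obtain \<epsilon> where \<epsilon>: "0 < ereal \<epsilon>" "ereal \<epsilon> < c" by (meson ereal_dense2)
      then obtain \<delta> where \<delta>: "\<delta> > 0" "pvar_close p T x A \<epsilon> \<delta>" using close by auto
      show "\<forall>\<^sub>F \<delta> in at_right 0. ?F \<delta> < c"
      proof (rule eventually_at_rightI[OF _ \<delta>(1)])
        fix \<delta>' assume "\<delta>' \<in> {0<..<\<delta>}"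
        then have "?F \<delta>' \<le> ereal \<epsilon>" unfolding le using pvar_close_antimono[OF \<delta>(2)] by auto
        then show "?F \<delta>' < c" using \<epsilon>(2) by simp
      qed
    qed
  }
qed

lemma rough_iff_pvar_close:
  assumes "0 < T"
  shows "x \<in> rough p T \<longleftrightarrow> continuous_on {0..T} x \<and>
     (\<exists>A :: real \<Rightarrow> real. continuous_on {0..T} A \<and> mono_on {0..T} A \<and> (\<forall>t\<in>{0..T}. 0 \<le> A t) \<and>
        A 0 = 0 \<and> A T > A 0 \<and> (\<forall>\<epsilon>>0. \<exists>\<delta>>0. pvar_close p T x A \<epsilon> \<delta>))"
  unfolding rough_def mem_Collect_eq tendsto_SUP_iff_pvar_close[OF assms] ..

lemma rough_cong:
  assumes "0 < T" and xy: "\<And>t. t \<in> {0..T} \<Longrightarrow> x t = y t"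
  shows "x \<in> rough p T \<longleftrightarrow> y \<in> rough p T"
proof -
  have "pvar p (shifted_grid T l s) x t = pvar p (shifted_grid T l s) y t" if "t \<in> {0..T}" for l s t
    using \<open>0 < T\<close> that xy by (intro pvar_cong[OF shifted_grid_subset]) auto
  then have "pvar_close p T x A \<epsilon> \<delta> \<longleftrightarrow> pvar_close p T y A \<epsilon> \<delta>" for A \<epsilon> \<delta>
    by (simp add: pvar_close_def)
  moreover have "continuous_on {0..T} x \<longleftrightarrow> continuous_on {0..T} y"
    using xy by (rule continuous_on_cong[OF refl])
  ultimately show ?thesis unfolding rough_iff_pvar_close[OF \<open>0 < T\<close>] by simp
qed

section \<open>Stability of roughness under Lipschitz perturbations\<close>

text \<open>If \<open>\<bar>b\<bar> \<le> \<eta> * \<bar>a\<bar>\<close>, the relative change of a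
  is at most \<open>\<eta>\<close>, and continuity of the power at 1 gives the first term. Otherwise
  a and a + b are both at most \<open>1 + 1 / \<eta>\<close> times b in absolute value, which gives
  the second.\<close>

lemma abs_powr_add_diff_le:
  fixes p \<epsilon> :: real
  assumes "0 < p" "0 < \<epsilon>"
  obtains C where "\<And>a b :: real. \<bar>\<bar>a + b\<bar> powr p - \<bar>a\<bar> powr p\<bar> \<le> \<epsilon> * \<bar>a\<bar> powr p + C * \<bar>b\<bar> powr p"
proof -
  have "((\<lambda>\<eta>::real. (1 + \<eta>) powr p) \<longlongrightarrow> (1 + 0) powr p) (at_right 0)"
    "((\<lambda>\<eta>::real. (1 - \<eta>) powr p) \<longlongrightarrow> (1 - 0) powr p) (at_right 0)"
    by (intro tendsto_intros; simp)+
  then have "\<forall>\<^sub>F \<eta>::real in at_right 0. (1 + \<eta>) powr p < 1 + \<epsilon> \<and> (1 - \<eta>) powr p > 1 - \<epsilon>"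
    using \<open>0 < \<epsilon>\<close> by (intro eventually_conj) (auto elim: order_tendstoD)
  then have "\<forall>\<^sub>F \<eta>::real in at_right 0. (1 + \<eta>) powr p < 1 + \<epsilon> \<and> (1 - \<eta>) powr p > 1 - \<epsilon> \<and> \<eta> \<in> {0<..<1}"
    using eventually_at_right_real[of 0 "1::real", OF zero_less_one] by eventually_elim auto
  then obtain \<eta> :: real where \<eta>: "(1 + \<eta>) powr p < 1 + \<epsilon>" "(1 - \<eta>) powr p > 1 - \<epsilon>" "0 < \<eta>" "\<eta> < 1"
    using eventually_happens'[of "at_right (0::real)"] by auto
  have "\<bar>\<bar>a + b\<bar> powr p - \<bar>a\<bar> powr p\<bar> \<le> \<epsilon> * \<bar>a\<bar> powr p + (1 + 1 / \<eta>) powr p * \<bar>b\<bar> powr p" for a b :: real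
  proof (cases "\<bar>b\<bar> \<le> \<eta> * \<bar>a\<bar>")
    case True
    have "\<bar>a + b\<bar> \<le> (1 + \<eta>) * \<bar>a\<bar>" "(1 - \<eta>) * \<bar>a\<bar> \<le> \<bar>a + b\<bar>"
      using True by (auto simp: algebra_simps)
    then have "\<bar>a + b\<bar> powr p \<le> ((1 + \<eta>) * \<bar>a\<bar>) powr p" "((1 - \<eta>) * \<bar>a\<bar>) powr p \<le> \<bar>a + b\<bar> powr p"
      using \<eta> \<open>0 < p\<close> by (auto intro!: powr_mono2)
    moreover have "((1 + \<eta>) * \<bar>a\<bar>) powr p = (1 + \<eta>) powr p * \<bar>a\<bar> powr p"
      "((1 - \<eta>) * \<bar>a\<bar>) powr p = (1 - \<eta>) powr p * \<bar>a\<bar> powr p"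
      using \<eta> by (auto simp: powr_mult)
    moreover have "(1 + \<eta>) powr p * \<bar>a\<bar> powr p \<le> (1 + \<epsilon>) * \<bar>a\<bar> powr p"
      "(1 - \<epsilon>) * \<bar>a\<bar> powr p \<le> (1 - \<eta>) powr p * \<bar>a\<bar> powr p"
      using \<eta> by (auto intro!: mult_right_mono)
    moreover have "\<bar>X - Y\<bar> \<le> \<epsilon> * Y + Z" if "X \<le> (1 + \<epsilon>) * Y" "(1 - \<epsilon>) * Y \<le> X" "0 \<le> Z" for X Y Z
      using that by (simp add: abs_le_iff algebra_simps)
    ultimately show ?thesis by simp
  next
    case False
    have "\<bar>a\<bar> \<le> 1 / \<eta> * \<bar>b\<bar>" using False \<eta> by (simp add: field_simps)
    then have "\<bar>a\<bar> \<le> (1 + 1 / \<eta>) * \<bar>b\<bar>" "\<bar>a + b\<bar> \<le> (1 + 1 / \<eta>) * \<bar>b\<bar>"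
      by (auto simp: algebra_simps)
    then have "\<bar>a\<bar> powr p \<le> ((1 + 1 / \<eta>) * \<bar>b\<bar>) powr p" "\<bar>a + b\<bar> powr p \<le> ((1 + 1 / \<eta>) * \<bar>b\<bar>) powr p"
      using \<open>0 < p\<close> by (auto intro!: powr_mono2)
    moreover have "((1 + 1 / \<eta>) * \<bar>b\<bar>) powr p = (1 + 1 / \<eta>) powr p * \<bar>b\<bar> powr p"
      using \<eta> by (simp add: powr_mult)
    moreover have "0 \<le> \<bar>a + b\<bar> powr p" "0 \<le> \<bar>a\<bar> powr p" "0 \<le> \<epsilon> * \<bar>a\<bar> powr p"
      using \<open>0 < \<epsilon>\<close> by auto
    ultimately show ?thesis by linarith
  qed
  then show thesis by (rule that)
qed

text \<open>A step of length \<open>d \<le> l\<close> contributes at most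
  \<open>(L * d) powr p\<close>, hence at most \<open>L powr p * l powr (p - 1) * d\<close>, and the
  lengths d telescope to at most T.\<close>

lemma pvar_lipschitz_le:
  assumes "1 \<le> p" "0 < T" "0 \<le> s" "s < l" "t \<in> {0..T}" and g: "L-lipschitz_on {0..T} g"
  shows "pvar p (shifted_grid T l s) g t \<le> L powr p * l powr (p - 1) * T"
proof -
  have "0 < l" "0 \<le> L" using assms lipschitz_on_nonneg by auto
  obtain n where "T \<le> real n * l" using ex_grid_length[OF \<open>0 < l\<close>] by blast
  then have n: "T \<le> s + real n * l" using assms by simp
  define q where "q k = min (clamped_grid T l s k) t" for k
  have q: "q k \<in> {0..T}" for k
    using \<open>t \<in> {0..T}\<close> \<open>0 < T\<close> unfolding q_def clamped_grid_def by auto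
  have term_le: "\<bar>g (q (Suc k)) - g (q k)\<bar> powr p \<le> L powr p * l powr (p - 1) * (q (Suc k) - q k)" for k
  proof -
    define d where "d = q (Suc k) - q k"
    have "clamped_grid T l s k \<le> clamped_grid T l s (Suc k)"
      using \<open>0 < l\<close> by (intro monoD[OF clamped_grid_mono]) auto
    then have "0 \<le> d" unfolding d_def q_def by auto
    have "d \<le> l" using \<open>0 < l\<close> unfolding d_def q_def clamped_grid_def
      by (auto simp: max_def min_def algebra_simps)
    have "\<bar>g (q (Suc k)) - g (q k)\<bar> \<le> L * \<bar>d\<bar>"
      using lipschitz_onD[OF g q q] unfolding d_def dist_real_def .
    then have "\<bar>g (q (Suc k)) - g (q k)\<bar> powr p \<le> (L * d) powr p"
      using \<open>0 \<le> d\<close> \<open>1 \<le> p\<close> by (intro powr_mono2) auto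
    also have "\<dots> = L powr p * (d powr (p - 1) * d)"
      using \<open>0 \<le> d\<close> \<open>0 \<le> L\<close> by (cases "d = 0") (auto simp: powr_mult powr_diff)
    also have "\<dots> \<le> L powr p * (l powr (p - 1) * d)"
      using \<open>0 \<le> d\<close> \<open>d \<le> l\<close> \<open>1 \<le> p\<close> by (intro mult_left_mono mult_right_mono powr_mono2) auto
    finally show ?thesis by (simp add: d_def mult.assoc)
  qed
  have "pvar p (shifted_grid T l s) g t = (\<Sum>k<Suc n. \<bar>g (q (Suc k)) - g (q k)\<bar> powr p)"
    using pvar_shifted_grid[OF assms(2-4) n] by (simp add: q_def)
  also have "\<dots> \<le> (\<Sum>k<Suc n. L powr p * l powr (p - 1) * (q (Suc k) - q k))"
    by (intro sum_mono term_le)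
  also have "\<dots> = L powr p * l powr (p - 1) * (q (Suc n) - q 0)"
    unfolding sum_distrib_left[symmetric] by (subst sum_lessThan_telescope) simp
  also have "\<dots> \<le> L powr p * l powr (p - 1) * T"
    using \<open>t \<in> {0..T}\<close> \<open>0 < T\<close> unfolding q_def clamped_grid_def
    by (intro mult_left_mono) (auto simp: max_def min_def)
  finally show ?thesis .
qed

text \<open>The limit function of x serves for y as well: the variations of x and y differ by at
  most a small multiple of the variation of x, which stays bounded, plus a constant times that of g,
  which tends to 0.\<close>

lemma rough_add_lipschitz:
  assumes "1 < p" "0 < T" and x: "x \<in> rough p T" and g: "L-lipschitz_on {0..T} g"
    and y: "\<And>t. t \<in> {0..T} \<Longrightarrow> y t = x t + g t"
  shows "y \<in> rough p T"
proof -
  obtain A where cx: "continuous_on {0..T} x"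
    and A: "continuous_on {0..T} A" "mono_on {0..T} A" "\<forall>t\<in>{0..T}. 0 \<le> A t" "A 0 = 0" "A T > A 0"
    and close: "\<And>\<epsilon>. \<epsilon> > 0 \<Longrightarrow> \<exists>\<delta>>0. pvar_close p T x A \<epsilon> \<delta>"
    using x unfolding rough_iff_pvar_close[OF \<open>0 < T\<close>] by auto
  have "continuous_on {0..T} (\<lambda>t. x t + g t)"
    using cx lipschitz_on_continuous_on[OF g] by (intro continuous_intros)
  then have cy: "continuous_on {0..T} y" using y by (subst continuous_on_cong[OF refl]) auto
  have "\<exists>\<delta>>0. pvar_close p T y A \<epsilon> \<delta>" if "\<epsilon> > 0" for \<epsilon>
  proof -
    \<comment> \<open>For small l the variation of x is within 1 of A t, hence at most
      \<open>A T + 1\<close>; this choice makes its weighted contribution at most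
      \<open>\<epsilon> / 3\<close>.\<close>
    define \<epsilon>' where "\<epsilon>' = \<epsilon> / 3 / (A T + 1)"
    have "\<epsilon>' > 0" using A \<open>\<epsilon> > 0\<close> by (simp add: \<epsilon>'_def)
    obtain C where C: "\<And>a b :: real. \<bar>\<bar>a + b\<bar> powr p - \<bar>a\<bar> powr p\<bar> \<le> \<epsilon>' * \<bar>a\<bar> powr p + C * \<bar>b\<bar> powr p"
      using abs_powr_add_diff_le[of p \<epsilon>'] \<open>1 < p\<close> \<open>\<epsilon>' > 0\<close> by auto
    \<comment> \<open>Here \<open>1 < p\<close> enters: the exponent \<open>p - 1\<close> is
      positive, so the limit is 0. The sign of C is unknown, hence the absolute value.\<close>
    have "((\<lambda>l. \<bar>C\<bar> * (L powr p * l powr (p - 1) * T)) \<longlongrightarrow> \<bar>C\<bar> * (L powr p * 0 powr (p - 1) * T)) (at_right 0)"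
      using \<open>1 < p\<close> by (intro tendsto_intros) (auto simp: eventually_at_filter)
    then have "\<forall>\<^sub>F l in at_right 0. \<bar>C\<bar> * (L powr p * l powr (p - 1) * T) < \<epsilon> / 3"
      using \<open>\<epsilon> > 0\<close> by (intro order_tendstoD) auto
    then obtain b where b: "b > 0" "\<And>l. 0 < l \<Longrightarrow> l < b \<Longrightarrow> \<bar>C\<bar> * (L powr p * l powr (p - 1) * T) < \<epsilon> / 3"
      unfolding eventually_at_right_field by auto
    obtain \<delta>1 where \<delta>1: "\<delta>1 > 0" "pvar_close p T x A 1 \<delta>1" using close[of 1] by auto
    obtain \<delta>2 where \<delta>2: "\<delta>2 > 0" "pvar_close p T x A (\<epsilon> / 3) \<delta>2" using close[of "\<epsilon> / 3"] \<open>\<epsilon> > 0\<close> by auto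
    define \<delta> where "\<delta> = min (b / 2) (min \<delta>1 \<delta>2)"
    have "pvar_close p T y A \<epsilon> \<delta>"
      unfolding pvar_close_def
    proof (intro ballI)
      fix l s t assume lst: "l \<in> {0<..\<delta>}" "s \<in> {0..<l}" "t \<in> {0..T}"
      let ?P = "shifted_grid T l s"
      have P: "?P \<subseteq> {0..T}" using \<open>0 < T\<close> by (intro shifted_grid_subset) simp
      have "A t \<le> A T" using lst \<open>0 < T\<close> by (intro mono_onD[OF A(2)]) auto
      moreover have 1: "\<bar>pvar p ?P x t - A t\<bar> \<le> 1" "\<bar>pvar p ?P x t - A t\<bar> \<le> \<epsilon> / 3"
        using \<delta>1(2) \<delta>2(2) lst unfolding pvar_close_def \<delta>_def by auto
      ultimately have "pvar p ?P x t \<le> A T + 1" by linarith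
      then have "\<epsilon>' * pvar p ?P x t \<le> \<epsilon>' * (A T + 1)" using \<open>\<epsilon>' > 0\<close> by simp
      also have "\<dots> = \<epsilon> / 3" using A(4,5) by (intro iffD1[OF nonzero_eq_divide_eq \<epsilon>'_def]) auto
      finally have 2: "\<epsilon>' * pvar p ?P x t \<le> \<epsilon> / 3" .
      have "C * pvar p ?P g t \<le> \<bar>C\<bar> * pvar p ?P g t"
        by (intro mult_right_mono) (auto simp: pvar_nonneg)
      also have "\<dots> \<le> \<bar>C\<bar> * (L powr p * l powr (p - 1) * T)"
        using lst assms by (intro mult_left_mono pvar_lipschitz_le) auto
      also have "\<dots> \<le> \<epsilon> / 3" using lst b by (intro less_imp_le b(2)) (auto simp: \<delta>_def)
      finally have 3: "C * pvar p ?P g t \<le> \<epsilon> / 3" .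
      have "pvar p ?P y t = pvar p ?P (\<lambda>t. x t + g t) t"
        using P lst y by (intro pvar_cong) auto
      then have "\<bar>pvar p ?P y t - pvar p ?P x t\<bar> = \<bar>\<Sum>(u, v)\<in>cells ?P.
          \<bar>(x (min v t) - x (min u t)) + (g (min v t) - g (min u t))\<bar> powr p - \<bar>x (min v t) - x (min u t)\<bar> powr p\<bar>"
        unfolding pvar_def by (simp add: sum_subtractf[symmetric] case_prod_unfold algebra_simps)
      also have "\<dots> \<le> (\<Sum>(u, v)\<in>cells ?P.
          \<epsilon>' * \<bar>x (min v t) - x (min u t)\<bar> powr p + C * \<bar>g (min v t) - g (min u t)\<bar> powr p)"
        unfolding case_prod_unfold by (rule order_trans[OF sum_abs]) (intro sum_mono C)
      also have "\<dots> = \<epsilon>' * pvar p ?P x t + C * pvar p ?P g t"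
        unfolding pvar_def by (simp add: case_prod_unfold sum.distrib sum_distrib_left)
      finally have "\<bar>pvar p ?P y t - pvar p ?P x t\<bar> \<le> \<epsilon> / 3 + \<epsilon> / 3" using 2 3 by linarith
      then show "\<bar>pvar p ?P y t - A t\<bar> \<le> \<epsilon>" using 1 by linarith
    qed
    moreover have "\<delta> > 0" using b \<delta>1 \<delta>2 by (simp add: \<delta>_def)
    ultimately show ?thesis by blast
  qed
  then show ?thesis unfolding rough_iff_pvar_close[OF \<open>0 < T\<close>] using cy A by blast
qed

section \<open>Roughness as a countable condition\<close>

text \<open>A sublevel set of a continuous function is relatively closed, so it exhausts S once it
  contains a dense subset. This turns quantifiers over grid parameters and times into countable
  ones.\<close>

lemma continuous_le_dense:
  fixes f :: "'a::topological_space \<Rightarrow> real"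
  assumes "continuous_on S f" "D \<subseteq> S" "S \<subseteq> closure D"
  shows "(\<forall>z\<in>S. f z \<le> c) \<longleftrightarrow> (\<forall>z\<in>D. f z \<le> c)"
proof
  assume D: "\<forall>z\<in>D. f z \<le> c"
  obtain C where C: "closed C" "C \<inter> S = f -` {..c} \<inter> S"
    using assms(1) closed_atMost[of c] unfolding continuous_on_closed_invariant by blast
  have "D \<subseteq> C" using C(2) D assms(2) by auto
  then have "closure D \<subseteq> C" using C(1) by (rule closure_minimal)
  then show "\<forall>z\<in>S. f z \<le> c" using C(2) assms(3) by auto
qed (use assms(2) in auto)

text \<open>Eliminates the existentially quantified limit function: variations along the reference
  grids of spacing \<open>1 / Suc m\<close> and shift 0 take its place. Conversely, their uniform
  limit is the required A; continuity passes to it, monotonicity comes from varying the shift, and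
  the bound \<open>1 / Suc r\<close> keeps \<open>A T\<close> positive.\<close>

lemma rough_iff_Cauchy:
  assumes "0 < T" "0 < p" and x: "continuous_on {0..T} x"
  shows "x \<in> rough p T \<longleftrightarrow>
    (\<forall>k. \<exists>m. pvar_close p T x (pvar p (shifted_grid T (1 / Suc m) 0) x) (1 / Suc k) (1 / Suc m)) \<and>
    (\<exists>r m. \<forall>n\<ge>m. 1 / Suc r \<le> pvar p (shifted_grid T (1 / Suc n) 0) x T)"
    (is "_ \<longleftrightarrow> ?Cauchy \<and> ?pos")
proof
  let ?V = "\<lambda>n. pvar p (shifted_grid T (1 / Suc n) 0) x"
  assume "x \<in> rough p T"
  then obtain A where A: "A 0 = 0" "A T > A 0"
    and close: "\<And>\<epsilon>. \<epsilon> > 0 \<Longrightarrow> \<exists>\<delta>>0. pvar_close p T x A \<epsilon> \<delta>"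
    unfolding rough_iff_pvar_close[OF \<open>0 < T\<close>] by auto
  have ex: "\<exists>m. pvar_close p T x A \<epsilon> (1 / Suc m)" if "\<epsilon> > 0" for \<epsilon>
  proof -
    obtain \<delta> where "\<delta> > 0" "pvar_close p T x A \<epsilon> \<delta>" using close[OF \<open>\<epsilon> > 0\<close>] by blast
    moreover obtain m where "inverse (real (Suc m)) < \<delta>" using reals_Archimedean[OF \<open>\<delta> > 0\<close>] by blast
    ultimately show ?thesis using pvar_close_antimono[of p T x A \<epsilon> \<delta> "1 / Suc m"]
      by (auto simp: inverse_eq_divide)
  qed
  have V: "\<bar>?V n t - A t\<bar> \<le> \<epsilon>" if "pvar_close p T x A \<epsilon> (1 / Suc m)" "m \<le> n" "t \<in> {0..T}" for m n t \<epsilon>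
    using that unfolding pvar_close_def by (auto simp: frac_le)
  show "?Cauchy \<and> ?pos"
  proof
    have "\<exists>m. pvar_close p T x (?V m) \<epsilon> (1 / Suc m)" if "\<epsilon> > 0" for \<epsilon>
    proof -
      obtain m where m: "pvar_close p T x A (\<epsilon> / 2) (1 / Suc m)" using ex[of "\<epsilon> / 2"] \<open>\<epsilon> > 0\<close> by auto
      have "pvar_close p T x (?V m) \<epsilon> (1 / Suc m)"
        unfolding pvar_close_def
      proof (intro ballI)
        fix l s t assume lst: "l \<in> {0<..1 / real (Suc m)}" "s \<in> {0..<l}" "t \<in> {0..T}"
        have "\<bar>pvar p (shifted_grid T l s) x t - A t\<bar> \<le> \<epsilon> / 2"
          using m lst unfolding pvar_close_def by blast
        moreover have "\<bar>?V m t - A t\<bar> \<le> \<epsilon> / 2" using V[OF m order_refl] lst by blast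
        ultimately show "\<bar>pvar p (shifted_grid T l s) x t - ?V m t\<bar> \<le> \<epsilon>" by linarith
      qed
      then show ?thesis by blast
    qed
    then show ?Cauchy by simp
    \<comment> \<open>One half of \<open>A T\<close> is spent on the approximation error; the other
      half still exceeds \<open>1 / Suc r\<close>.\<close>
    obtain r where "inverse (real (Suc r)) < A T / 2" using reals_Archimedean[of "A T / 2"] A by auto
    then have r: "1 / Suc r < A T / 2" by (simp add: inverse_eq_divide)
    obtain m where m: "pvar_close p T x A (A T / 2) (1 / Suc m)" using ex[of "A T / 2"] A by auto
    have "1 / Suc r \<le> ?V n T" if "m \<le> n" for n
    proof -
      have "\<bar>?V n T - A T\<bar> \<le> A T / 2" using V[OF m that] \<open>0 < T\<close> by simp
      then show ?thesis using r by linarith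
    qed
    then show ?pos by blast
  qed
next
  let ?V = "\<lambda>n. pvar p (shifted_grid T (1 / Suc n) 0) x"
  assume "?Cauchy \<and> ?pos"
  then have Cauchy: ?Cauchy and ?pos by auto
  have ex: "\<exists>m. pvar_close p T x (?V m) \<epsilon> (1 / Suc m)" if "\<epsilon> > 0" for \<epsilon>
  proof -
    obtain k where "inverse (real (Suc k)) < \<epsilon>" using reals_Archimedean[OF \<open>\<epsilon> > 0\<close>] by blast
    then have "1 / Suc k \<le> \<epsilon>" by (simp add: inverse_eq_divide)
    moreover obtain m where "pvar_close p T x (?V m) (1 / Suc k) (1 / Suc m)" using Cauchy by blast
    ultimately show ?thesis unfolding pvar_close_def by (meson order_trans)
  qed
  have V: "\<bar>?V n t - ?V m t\<bar> \<le> \<epsilon>" if "pvar_close p T x (?V m) \<epsilon> (1 / Suc m)" "m \<le> n" "t \<in> {0..T}" for m n t \<epsilon>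
    using that unfolding pvar_close_def by (auto simp: frac_le)
  have "uniformly_Cauchy_on {0..T} ?V"
    unfolding uniformly_Cauchy_on_def
  proof (intro allI impI)
    fix \<epsilon> :: real assume "\<epsilon> > 0"
    then obtain m where m: "pvar_close p T x (?V m) (\<epsilon> / 3) (1 / Suc m)" using ex[of "\<epsilon> / 3"] by auto
    \<comment> \<open>Both grids have spacing at most \<open>1 / Suc m\<close>, so each variation is
      within \<open>\<epsilon> / 3\<close> of that along reference grid m; two thirds leave room for
      the strict inequality.\<close>
    have "dist (?V n t) (?V n' t) < \<epsilon>" if "m \<le> n" "m \<le> n'" "t \<in> {0..T}" for n n' t
      using V[OF m that(1,3)] V[OF m that(2,3)] \<open>\<epsilon> > 0\<close> unfolding dist_real_def by linarith
    then show "\<exists>M. \<forall>t\<in>{0..T}. \<forall>n\<ge>M. \<forall>n'\<ge>M. dist (?V n t) (?V n' t) < \<epsilon>" by blast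
  qed
  then obtain A where A: "uniform_limit {0..T} ?V A sequentially"
    using Cauchy_uniformly_convergent unfolding uniformly_convergent_on_def by blast
  have lim: "(\<lambda>n. ?V n t) \<longlonglongrightarrow> A t" if "t \<in> {0..T}" for t
    using tendsto_uniform_limitI[OF A that] .
  have close: "\<exists>\<delta>>0. pvar_close p T x A \<epsilon> \<delta>" if "\<epsilon> > 0" for \<epsilon>
  proof -
    obtain m where m: "pvar_close p T x (?V m) (\<epsilon> / 2) (1 / Suc m)" using ex[of "\<epsilon> / 2"] \<open>\<epsilon> > 0\<close> by auto
    have "pvar_close p T x A \<epsilon> (1 / Suc m)"
      unfolding pvar_close_def
    proof (intro ballI)
      fix l s t assume lst: "l \<in> {0<..1 / real (Suc m)}" "s \<in> {0..<l}" "t \<in> {0..T}"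
      have "(\<lambda>n. \<bar>?V n t - ?V m t\<bar>) \<longlonglongrightarrow> \<bar>A t - ?V m t\<bar>"
        using lim lst by (intro tendsto_intros) auto
      then have "\<bar>A t - ?V m t\<bar> \<le> \<epsilon> / 2"
        using V[OF m] lst by (intro LIMSEQ_le_const2[where X = "\<lambda>n. \<bar>?V n t - ?V m t\<bar>"]) blast+
      moreover have "\<bar>pvar p (shifted_grid T l s) x t - ?V m t\<bar> \<le> \<epsilon> / 2"
        using m lst unfolding pvar_close_def by blast
      ultimately show "\<bar>pvar p (shifted_grid T l s) x t - A t\<bar> \<le> \<epsilon>" by linarith
    qed
    then show ?thesis by (intro exI[of _ "1 / Suc m"]) auto
  qed
  have "continuous_on {0..T} (?V n)" for n
  proof -
    have "continuous_on {0..T} (\<lambda>t. case (1 / real (Suc n), 0, t) of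
        (l, s, t) \<Rightarrow> pvar p (shifted_grid T l s) x t)"
      using assms by (intro continuous_on_compose2[OF
          continuous_on_pvar_shifted_grid[of T x p "1 / Suc n" "{1 / real (Suc n)} \<times> {0} \<times> {0..T}"]]
          continuous_intros) auto
    then show ?thesis by simp
  qed
  then have cA: "continuous_on {0..T} A"
    by (intro uniform_limit_theorem[OF _ A]) auto
  \<comment> \<open>\<open>pvar\<close> is not monotone in \<open>t\<close> along a fixed grid; shift the grid so that it contains \<open>u\<close>.\<close>
  have mono: "A u \<le> A t" if "u \<in> {0..T}" "t \<in> {0..T}" "u \<le> t" for u t
  proof (rule field_le_epsilon)
    fix \<epsilon> :: real assume "\<epsilon> > 0"
    then obtain l where l: "l > 0" "pvar_close p T x A (\<epsilon> / 2) l" using close[of "\<epsilon> / 2"] by auto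
    obtain s where s: "s \<in> {0..<l}" "u \<in> shifted_grid T l s"
      using ex_shift_through_point[OF l(1) \<open>u \<in> _\<close>] by blast
    have "\<bar>pvar p (shifted_grid T l s) x u - A u\<bar> \<le> \<epsilon> / 2" "\<bar>pvar p (shifted_grid T l s) x t - A t\<bar> \<le> \<epsilon> / 2"
      using l s that unfolding pvar_close_def by auto
    moreover have "pvar p (shifted_grid T l s) x u \<le> pvar p (shifted_grid T l s) x t"
      using s(2) that(3) by (rule pvar_mono_from_grid_point)
    ultimately show "A u \<le> A t + \<epsilon>" by linarith
  qed
  have "A 0 = 0"
  proof (rule LIMSEQ_unique)
    show "(\<lambda>n. ?V n 0) \<longlonglongrightarrow> A 0" using lim \<open>0 < T\<close> by auto
    show "(\<lambda>n. ?V n 0) \<longlonglongrightarrow> 0"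
      using \<open>0 < T\<close> pvar_at_0[OF shifted_grid_subset[of T]] by simp
  qed
  obtain r m where r: "\<And>n. m \<le> n \<Longrightarrow> 1 / Suc r \<le> ?V n T" using \<open>?pos\<close> by blast
  have "1 / Suc r \<le> A T"
    using \<open>0 < T\<close> r by (intro LIMSEQ_le_const[OF lim]) auto
  moreover have "0 < 1 / real (Suc r)" by simp
  ultimately have "A 0 < A T" using \<open>A 0 = 0\<close> by linarith
  moreover have "0 \<le> A t" if "t \<in> {0..T}" for t using mono[of 0 t] that \<open>A 0 = 0\<close> by auto
  moreover have "mono_on {0..T} A" using mono by (intro mono_onI) auto
  ultimately show "x \<in> rough p T"
    unfolding rough_iff_pvar_close[OF \<open>0 < T\<close>] using x cA \<open>A 0 = 0\<close> close by blast
qed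

lemma measurable_pvar:
  assumes "P \<subseteq> {0..T}" "t \<in> {0..T}"
    and "\<And>t. t \<in> {0..T} \<Longrightarrow> (\<lambda>\<omega>. Y \<omega> t) \<in> borel_measurable N"
  shows "(\<lambda>\<omega>. pvar p P (Y \<omega>) t) \<in> borel_measurable N"
  unfolding pvar_def
proof (intro borel_measurable_sum)
  fix c assume "c \<in> cells P"
  moreover obtain u v where c: "c = (u, v)" by (cases c)
  ultimately have "u \<in> {0..T}" "v \<in> {0..T}" using assms(1) by (auto simp: cells_def)
  then have [measurable]: "(\<lambda>\<omega>. Y \<omega> (min u t)) \<in> borel_measurable N" "(\<lambda>\<omega>. Y \<omega> (min v t)) \<in> borel_measurable N"
    using assms(2) by (auto intro!: assms(3))
  show "(\<lambda>\<omega>. case c of (u, v) \<Rightarrow> \<bar>Y \<omega> (min v t) - Y \<omega> (min u t)\<bar> powr p) \<in> borel_measurable N"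
    unfolding c by simp
qed

text \<open>For continuous paths the Cauchy criterion involves the parameters (l, s, t) only through
  non-strict inequalities between functions continuous in them. It can thus be tested on countable
  dense sets, where each condition is measurable. U confines the argument to continuous
  paths.\<close>

lemma sets_Collect_rough:
  assumes "0 < T" "0 < p" and [measurable]: "U \<in> sets N"
    and Y: "\<And>t. t \<in> {0..T} \<Longrightarrow> (\<lambda>\<omega>. Y \<omega> t) \<in> borel_measurable N"
    and cont: "\<And>\<omega>. \<omega> \<in> U \<Longrightarrow> continuous_on {0..T} (Y \<omega>)"
  shows "{\<omega>\<in>U. Y \<omega> \<in> rough p T} \<in> sets N"
proof -
  \<comment> \<open>The lower bound on \<open>l\<close> keeps the number of grid points bounded, as needed for continuity.\<close>
  define S where "S m r = {(l, s, t). 1 / real (Suc r) \<le> l \<and> l \<le> 1 / real (Suc m) \<and> 0 \<le> s \<and> s < l \<and> 0 \<le> t \<and> t \<le> T}"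
    for m r
  have "\<exists>D. countable D \<and> D \<subseteq> S m r \<and> S m r \<subseteq> closure D" for m r
    using separable[of "S m r"] by metis
  then obtain D where D: "\<And>m r. countable (D m r)" "\<And>m r. D m r \<subseteq> S m r" "\<And>m r. S m r \<subseteq> closure (D m r)"
    by metis
  define V where "V z \<omega> = (case z of (l, s, t) \<Rightarrow> pvar p (shifted_grid T l s) (Y \<omega>) t)" for z \<omega>
  have V[measurable]: "V (l, s, t) \<in> borel_measurable N" if "t \<in> {0..T}" for l s t
    unfolding V_def prod.case using \<open>0 < T\<close> that Y by (intro measurable_pvar[OF shifted_grid_subset]) auto
  \<comment> \<open>Compares the grid given by z with reference grid m at the same time, the last
    component of z.\<close>
  let ?W = "\<lambda>m z \<omega>. \<bar>V z \<omega> - V (1 / Suc m, 0, snd (snd z)) \<omega>\<bar>"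
  have W[measurable]: "?W m z \<in> borel_measurable N" if "z \<in> D m r" for m r z
  proof -
    obtain l s t where z: "z = (l, s, t)" by (cases z)
    then have "t \<in> {0..T}" using that D(2)[of m r] by (auto simp: S_def)
    then show ?thesis unfolding z by simp
  qed
  have VT[measurable]: "V (1 / Suc n, 0, T) \<in> borel_measurable N" for n using \<open>0 < T\<close> by auto
  have "Y \<omega> \<in> rough p T \<longleftrightarrow> (\<forall>k. \<exists>m. \<forall>r. \<forall>z\<in>D m r. ?W m z \<omega> \<le> 1 / Suc k) \<and>
      (\<exists>r m. \<forall>n\<ge>m. 1 / Suc r \<le> V (1 / Suc n, 0, T) \<omega>)" if "\<omega> \<in> U" for \<omega>
  proof -
    have W_cont: "continuous_on (S m r) (\<lambda>z. ?W m z \<omega>)" for m r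
    proof -
      have 1: "continuous_on (S m r) (\<lambda>z. V z \<omega>)"
        unfolding V_def using assms(1,2) cont[OF that]
        by (intro continuous_on_pvar_shifted_grid[of _ _ _ "1 / Suc r"]) (auto simp: S_def)
      have "continuous_on ({1 / real (Suc m)} \<times> {0} \<times> {0..T}) (\<lambda>z. V z \<omega>)"
        unfolding V_def using assms(1,2) cont[OF that]
        by (intro continuous_on_pvar_shifted_grid[of _ _ _ "1 / Suc m"]) auto
      then have "continuous_on (S m r) (\<lambda>z. V (1 / Suc m, 0, snd (snd z)) \<omega>)"
        by (rule continuous_on_compose2) (auto simp: S_def intro!: continuous_intros)
      with 1 show ?thesis by (intro continuous_intros)
    qed
    have "pvar_close p T (Y \<omega>) (pvar p (shifted_grid T (1 / Suc m) 0) (Y \<omega>)) \<epsilon> (1 / Suc m) \<longleftrightarrow>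
        (\<forall>r. \<forall>z\<in>D m r. ?W m z \<omega> \<le> \<epsilon>)" for m \<epsilon>
    proof -
      \<comment> \<open>For fixed m, the sets \<open>S m r\<close> exhaust all spacings in
        \<open>{0<..1 / Suc m}\<close> as r grows.\<close>
      have "pvar_close p T (Y \<omega>) (pvar p (shifted_grid T (1 / Suc m) 0) (Y \<omega>)) \<epsilon> (1 / Suc m) \<longleftrightarrow>
          (\<forall>r. \<forall>z\<in>S m r. ?W m z \<omega> \<le> \<epsilon>)"
      proof
        assume R: "\<forall>r. \<forall>z\<in>S m r. ?W m z \<omega> \<le> \<epsilon>"
        show "pvar_close p T (Y \<omega>) (pvar p (shifted_grid T (1 / Suc m) 0) (Y \<omega>)) \<epsilon> (1 / Suc m)"
          unfolding pvar_close_def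
        proof (intro ballI)
          fix l s t assume lst: "l \<in> {0<..1 / real (Suc m)}" "s \<in> {0..<l}" "t \<in> {0..T}"
          obtain r where "inverse (real (Suc r)) < l" using reals_Archimedean[of l] lst by auto
          then have "(l, s, t) \<in> S m r" using lst by (auto simp: S_def inverse_eq_divide)
          then show "\<bar>pvar p (shifted_grid T l s) (Y \<omega>) t - pvar p (shifted_grid T (1 / Suc m) 0) (Y \<omega>) t\<bar> \<le> \<epsilon>"
            using R by (fastforce simp: V_def)
        qed
      next
        assume L: "pvar_close p T (Y \<omega>) (pvar p (shifted_grid T (1 / Suc m) 0) (Y \<omega>)) \<epsilon> (1 / Suc m)"
        show "\<forall>r. \<forall>z\<in>S m r. ?W m z \<omega> \<le> \<epsilon>"
        proof (intro allI ballI)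
          fix r z assume "z \<in> S m r"
          then obtain l s t where z: "z = (l, s, t)" "0 < l" "l \<le> 1 / Suc m" "0 \<le> s" "s < l" "t \<in> {0..T}"
            unfolding S_def by (auto dest: less_le_trans[rotated])
          then show "?W m z \<omega> \<le> \<epsilon>" using L unfolding pvar_close_def V_def by auto
        qed
      qed
      also have "\<dots> \<longleftrightarrow> (\<forall>r. \<forall>z\<in>D m r. ?W m z \<omega> \<le> \<epsilon>)"
        using continuous_le_dense[OF W_cont D(2,3)] by auto
      finally show ?thesis .
    qed
    then show ?thesis
      unfolding rough_iff_Cauchy[OF assms(1,2) cont[OF that]] by (simp add: V_def)
  qed
  then have "{\<omega>\<in>U. Y \<omega> \<in> rough p T} = U \<inter> {\<omega>\<in>space N. (\<forall>k. \<exists>m. \<forall>r. \<forall>z\<in>D m r. ?W m z \<omega> \<le> 1 / Suc k) \<and>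
      (\<exists>r m. \<forall>n\<ge>m. 1 / Suc r \<le> V (1 / Suc n, 0, T) \<omega>)}"
    using sets.sets_into_space[OF \<open>U \<in> sets N\<close>] by auto
  also have "\<dots> \<in> sets N"
  proof (intro sets.Int sets.sets_Collect_conj \<open>U \<in> sets N\<close> sets.sets_Collect_countable_All sets.sets_Collect_countable_Ex)
    show "{\<omega>\<in>space N. \<forall>z\<in>D m r. ?W m z \<omega> \<le> 1 / Suc k} \<in> sets N" for k m r
      using W by (intro sets.sets_Collect_countable_All' D(1) borel_measurable_le) auto
    show "{\<omega>\<in>space N. m \<le> n \<longrightarrow> 1 / Suc r \<le> V (1 / Suc n, 0, T) \<omega>} \<in> sets N" for r m n
      by measurable
  qed
  finally show ?thesis .
qed

text \<open>Uniform limits agree on \<open>{0..T}\<close>, and roughness ignores values elsewhere.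
  Roughness of a series can therefore be expressed through its partial sums alone.\<close>

lemma ex_rough_limit_iff:
  assumes "0 < T" "uniform_limit {0..T} F y sequentially"
  shows "(\<exists>y\<in>rough p T. uniform_limit {0..T} F y sequentially) \<longleftrightarrow> y \<in> rough p T"
proof
  assume "\<exists>y\<in>rough p T. uniform_limit {0..T} F y sequentially"
  then obtain z where z: "z \<in> rough p T" "uniform_limit {0..T} F z sequentially" by blast
  have "z t = y t" if "t \<in> {0..T}" for t
    using LIMSEQ_unique[OF tendsto_uniform_limitI[OF z(2) that] tendsto_uniform_limitI[OF assms(2) that]] .
  then show "y \<in> rough p T" using rough_cong[OF assms(1)] z(1) by blast
qed (use assms(2) in blast)

text \<open>A uniform limit exists exactly when the sequence is uniformly Cauchy, which for
  continuous functions can be tested on a countable dense set of times. On this event the pointwise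
  limit is a measurable family of continuous paths.\<close>

lemma sets_Collect_uniform_limit_rough:
  assumes "0 < T" "0 < p"
    and S[measurable]: "\<And>n t. (\<lambda>\<omega>. S n \<omega> t) \<in> borel_measurable N"
    and cont: "\<And>n \<omega>. continuous_on {0..T} (S n \<omega>)"
  shows "{\<omega>\<in>space N. \<exists>y\<in>rough p T. uniform_limit {0..T} (\<lambda>n. S n \<omega>) y sequentially} \<in> sets N"
proof -
  obtain D where D: "countable D" "D \<subseteq> {0..T}" "{0..T} \<subseteq> closure D" using separable by metis
  define U where "U = {\<omega>\<in>space N. \<forall>k. \<exists>M. \<forall>m\<ge>M. \<forall>n\<ge>M. \<forall>t\<in>D. \<bar>S m \<omega> t - S n \<omega> t\<bar> \<le> 1 / Suc k}"
  \<comment> \<open>Where the sequence diverges, \<open>lim\<close> has an unspecified value; Y is a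
    limit of paths only on U, and roughness is tested only there.\<close>
  define Y where "Y \<omega> t = lim (\<lambda>n. S n \<omega> t)" for \<omega> t
  have "U \<in> sets N"
  proof -
    have [measurable]: "Measurable.pred N (\<lambda>\<omega>. \<forall>t\<in>D. \<bar>S m \<omega> t - S n \<omega> t\<bar> \<le> c)" for m n c
      unfolding pred_def by (intro sets.sets_Collect_countable_All' D(1)) measurable
    show ?thesis unfolding U_def by measurable
  qed
  have U_iff: "\<omega> \<in> U \<longleftrightarrow> \<omega> \<in> space N \<and> uniformly_Cauchy_on {0..T} (\<lambda>n. S n \<omega>)" for \<omega>
  proof -
    have "(\<forall>t\<in>D. \<bar>S m \<omega> t - S n \<omega> t\<bar> \<le> c) \<longleftrightarrow> (\<forall>t\<in>{0..T}. \<bar>S m \<omega> t - S n \<omega> t\<bar> \<le> c)" for m n c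
      by (rule continuous_le_dense[symmetric, OF _ D(2,3)]) (intro continuous_intros cont)
    moreover have "(\<forall>k. \<exists>M. \<forall>m\<ge>M. \<forall>n\<ge>M. \<forall>t\<in>{0..T}. \<bar>S m \<omega> t - S n \<omega> t\<bar> \<le> 1 / Suc k) \<longleftrightarrow>
        uniformly_Cauchy_on {0..T} (\<lambda>n. S n \<omega>)" (is "?L \<longleftrightarrow> _")
    proof
      assume L: ?L
      show "uniformly_Cauchy_on {0..T} (\<lambda>n. S n \<omega>)"
        unfolding uniformly_Cauchy_on_def dist_real_def
      proof (intro allI impI)
        fix \<epsilon> :: real assume "\<epsilon> > 0"
        then obtain k where "inverse (real (Suc k)) < \<epsilon>" using reals_Archimedean by blast
        then have "1 / Suc k < \<epsilon>" by (simp add: inverse_eq_divide)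
        then show "\<exists>M. \<forall>t\<in>{0..T}. \<forall>m\<ge>M. \<forall>n\<ge>M. \<bar>S m \<omega> t - S n \<omega> t\<bar> < \<epsilon>"
          using L by (meson le_less_trans)
      qed
    next
      assume R: "uniformly_Cauchy_on {0..T} (\<lambda>n. S n \<omega>)"
      show ?L
      proof
        fix k
        have "1 / real (Suc k) > 0" by simp
        then show "\<exists>M. \<forall>m\<ge>M. \<forall>n\<ge>M. \<forall>t\<in>{0..T}. \<bar>S m \<omega> t - S n \<omega> t\<bar> \<le> 1 / Suc k"
          using R unfolding uniformly_Cauchy_on_def dist_real_def by (meson less_imp_le)
      qed
    qed
    ultimately show ?thesis by (simp add: U_def)
  qed
  have lim: "uniform_limit {0..T} (\<lambda>n. S n \<omega>) (Y \<omega>) sequentially" if "\<omega> \<in> U" for \<omega>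
    using that uniformly_convergent_uniform_limit_iff[of "{0..T}" "\<lambda>n. S n \<omega>"]
      Cauchy_uniformly_convergent unfolding U_iff Y_def by blast
  have "(\<exists>y\<in>rough p T. uniform_limit {0..T} (\<lambda>n. S n \<omega>) y sequentially) \<longleftrightarrow> \<omega> \<in> U \<and> Y \<omega> \<in> rough p T"
    if "\<omega> \<in> space N" for \<omega>
  proof (cases "\<omega> \<in> U")
    case True
    then show ?thesis using ex_rough_limit_iff[OF assms(1) lim[OF True]] by simp
  next
    case False
    then have "\<not> uniformly_convergent_on {0..T} (\<lambda>n. S n \<omega>)"
      using that uniformly_convergent_Cauchy unfolding U_iff by blast
    then show ?thesis using False unfolding uniformly_convergent_on_def by blast
  qed
  moreover have "U \<subseteq> space N" by (auto simp: U_def)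
  ultimately have "{\<omega>\<in>space N. \<exists>y\<in>rough p T. uniform_limit {0..T} (\<lambda>n. S n \<omega>) y sequentially} =
      {\<omega>\<in>U. Y \<omega> \<in> rough p T}"
    by auto
  also have "\<dots> \<in> sets N"
  proof (rule sets_Collect_rough[OF assms(1,2) \<open>U \<in> sets N\<close>])
    show "(\<lambda>\<omega>. Y \<omega> t) \<in> borel_measurable N" for t unfolding Y_def by measurable
    show "continuous_on {0..T} (Y \<omega>)" if "\<omega> \<in> U" for \<omega>
      using cont by (intro uniform_limit_theorem[OF _ lim[OF that]]) auto
  qed
  finally show ?thesis .
qed

section \<open>Lipschitz continuity of Schauder functions\<close>

lemma is_haar_bounded:
  assumes "is_haar T x y z h"
  obtains K where "0 \<le> K" "\<And>t. \<bar>h t\<bar> \<le> K"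
proof -
  obtain \<alpha> \<beta> where \<alpha>\<beta>: "\<alpha> > 0" "\<beta> < 0" and h: "\<forall>t\<in>{x..<y}. h t = \<alpha>" "\<forall>t\<in>{y..<z}. h t = \<beta>"
    "\<forall>t. t \<notin> {x..<z} \<longrightarrow> h t = 0"
    using assms unfolding is_haar_def by blast
  have "\<bar>h t\<bar> \<le> max \<alpha> (- \<beta>)" for t
  proof (cases "t \<in> {x..<z}")
    case True
    then have "t \<in> {x..<y} \<or> t \<in> {y..<z}" by auto
    then show ?thesis using h \<alpha>\<beta> by auto
  next
    case False
    then show ?thesis using h \<alpha>\<beta> by auto
  qed
  then show thesis using \<alpha>\<beta> by (intro that[of "max \<alpha> (- \<beta>)"]) auto
qed

lemma integral_lipschitz:
  fixes h :: "real \<Rightarrow> real"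
  assumes "h integrable_on {a..b}" "0 \<le> K" "\<And>t. \<bar>h t\<bar> \<le> K"
  shows "K-lipschitz_on {a..b} (\<lambda>t. integral {a..t} h)"
proof (rule lipschitz_on_leI)
  fix u v assume uv: "u \<in> {a..b}" "v \<in> {a..b}" "u \<le> v"
  have int: "h integrable_on {a..v}" "h integrable_on {u..v}"
    using assms(1) uv by (auto intro: integrable_on_subinterval)
  have "\<bar>integral {u..v} h\<bar> \<le> K * (v - u)"
    using has_integral_bound_real[OF assms(2) finite.emptyI integrable_integral[OF int(2)]] assms(3) uv by simp
  moreover have "integral {a..u} h + integral {u..v} h = integral {a..v} h"
    using uv int by (intro Henstock_Kurzweil_Integration.integral_combine) auto
  ultimately show "dist (integral {a..u} h) (integral {a..v} h) \<le> K * dist u v"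
    using uv by (simp add: dist_real_def)
qed (rule assms)

text \<open>A primitive of a bounded integrable function is Lipschitz. This is what makes finitely
  many levels invisible to the p-th variation in the limit.\<close>

lemma faber_schauder_lipschitz:
  assumes "faber_schauder T \<pi> J e" "j \<in> J i"
  obtains L where "L-lipschitz_on {0..T} (e i j)"
proof -
  obtain x y z h where h: "is_haar T x y z h" and e: "\<And>t. t \<in> {0..T} \<Longrightarrow> e i j t = integral {0..t} h"
    using assms unfolding faber_schauder_def Let_def by (metis surj_pair)
  obtain K where K: "0 \<le> K" "\<And>t. \<bar>h t\<bar> \<le> K" using is_haar_bounded[OF h] by blast
  have "h integrable_on {0..T}" using h unfolding is_haar_def by blast
  then have "K-lipschitz_on {0..T} (\<lambda>t. integral {0..t} h)" using K by (rule integral_lipschitz)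
  then have "K-lipschitz_on {0..T} (e i j)" using e by (rule lipschitz_on_transform)
  then show thesis by (rule that)
qed

lemma ex_lipschitz_on_sum:
  fixes f :: "'i \<Rightarrow> 'a::metric_space \<Rightarrow> 'b::real_normed_vector"
  assumes "\<And>i. i \<in> I \<Longrightarrow> \<exists>L. L-lipschitz_on X (f i)"
  shows "\<exists>L. L-lipschitz_on X (\<lambda>t. \<Sum>i\<in>I. f i t)"
  using assms
proof (induction I rule: infinite_finite_induct)
  case (insert i I)
  then obtain L L' where "L-lipschitz_on X (f i)" "L'-lipschitz_on X (\<lambda>t. \<Sum>i\<in>I. f i t)" by blast
  then have "(L + L')-lipschitz_on X (\<lambda>t. f i t + (\<Sum>i\<in>I. f i t))" by (rule lipschitz_on_add)
  then show ?case using insert by auto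
qed (auto intro: lipschitz_on_constant)

section \<open>Roughness of the tail series\<close>

definition fs_sum ::
    "(nat \<Rightarrow> 'j set) \<Rightarrow> (nat \<Rightarrow> 'j \<Rightarrow> real \<Rightarrow> real) \<Rightarrow> (nat \<Rightarrow> 'j \<Rightarrow> real) \<Rightarrow> nat set \<Rightarrow> real \<Rightarrow> real" where
  "fs_sum J e c I t = (\<Sum>i\<in>I. \<Sum>j\<in>J i. c i j * e i j t)"

lemma fs_sum_lipschitz:
  assumes "faber_schauder T \<pi> J e"
  obtains L where "L-lipschitz_on {0..T} (fs_sum J e c I)"
proof -
  have "\<exists>L. L-lipschitz_on {0..T} (\<lambda>t. \<Sum>i\<in>I. \<Sum>j\<in>J i. c i j * e i j t)"
    by (intro ex_lipschitz_on_sum) (metis faber_schauder_lipschitz[OF assms] lipschitz_on_cmult_real)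
  then show thesis using that unfolding fs_sum_def[abs_def] by blast
qed

text \<open>Convergence is part of the predicate, so it makes sense for every coefficient family. It
  sees neither X(0) nor a, nor any level below n.\<close>

definition rough_tail ::
    "real \<Rightarrow> real \<Rightarrow> (nat \<Rightarrow> 'j set) \<Rightarrow> (nat \<Rightarrow> 'j \<Rightarrow> real \<Rightarrow> real) \<Rightarrow> nat \<Rightarrow> (nat \<Rightarrow> 'j \<Rightarrow> real) \<Rightarrow> bool" where
  "rough_tail p T J e n c \<longleftrightarrow>
     (\<exists>y\<in>rough p T. uniform_limit {0..T} (\<lambda>m. fs_sum J e c {n..<m}) y sequentially)"

text \<open>The function g will be a block of initial levels or the affine part of the expansion.
  The relation is asked only for large m, since splitting off the levels below n is valid only from
  \<open>m = n\<close> on.\<close>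

lemma ex_rough_limit_add_lipschitz:
  assumes "1 < p" "0 < T" "L-lipschitz_on {0..T} g"
    and "\<forall>\<^sub>F m in sequentially. \<forall>t\<in>{0..T}. F' m t = F m t + g t"
    and "\<exists>y\<in>rough p T. uniform_limit {0..T} F y sequentially"
  shows "\<exists>y\<in>rough p T. uniform_limit {0..T} F' y sequentially"
proof -
  obtain y where y: "y \<in> rough p T" "uniform_limit {0..T} F y sequentially" using assms(5) by blast
  have "uniform_limit {0..T} (\<lambda>m t. F m t + g t) (\<lambda>t. y t + g t) sequentially"
    by (intro uniform_limit_intros y(2))
  moreover have "uniform_limit {0..T} F' (\<lambda>t. y t + g t) sequentially \<longleftrightarrow>
      uniform_limit {0..T} (\<lambda>m t. F m t + g t) (\<lambda>t. y t + g t) sequentially"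
    by (rule uniform_limit_cong[OF assms(4)]) simp
  ultimately have "uniform_limit {0..T} F' (\<lambda>t. y t + g t) sequentially" by simp
  moreover have "(\<lambda>t. y t + g t) \<in> rough p T"
    by (rule rough_add_lipschitz[OF assms(1,2) y(1) assms(3)]) (rule refl)
  ultimately show ?thesis by blast
qed

lemma ex_rough_limit_add_lipschitz_iff:
  assumes "1 < p" "0 < T" "L-lipschitz_on {0..T} g"
    and "\<forall>\<^sub>F m in sequentially. \<forall>t\<in>{0..T}. F' m t = F m t + g t"
  shows "(\<exists>y\<in>rough p T. uniform_limit {0..T} F y sequentially) \<longleftrightarrow>
    (\<exists>y\<in>rough p T. uniform_limit {0..T} F' y sequentially)"
proof -
  have "\<forall>\<^sub>F m in sequentially. \<forall>t\<in>{0..T}. F m t = F' m t + - g t"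
    using assms(4) by eventually_elim simp
  then show ?thesis
    using ex_rough_limit_add_lipschitz[OF assms]
      ex_rough_limit_add_lipschitz[OF assms(1,2) lipschitz_on_minus[OF assms(3)]] by blast
qed

text \<open>The two series differ by the first n levels, a finite combination of Schauder functions
  and hence Lipschitz. This is the source of the tail property.\<close>

lemma rough_tail_iff:
  assumes "1 < p" "0 < T" and fs: "faber_schauder T \<pi> J e"
  shows "rough_tail p T J e n c \<longleftrightarrow> rough_tail p T J e 0 c"
proof -
  obtain L where L: "L-lipschitz_on {0..T} (fs_sum J e c {0..<n})" using fs_sum_lipschitz[OF fs] by blast
  have "\<forall>\<^sub>F m in sequentially. \<forall>t\<in>{0..T}.
      fs_sum J e c {0..<m} t = fs_sum J e c {n..<m} t + fs_sum J e c {0..<n} t"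
    using eventually_ge_at_top[of n]
  proof eventually_elim
    case (elim m)
    then show ?case
      unfolding fs_sum_def by (subst sum.atLeastLessThan_concat[symmetric, of 0 n m]) auto
  qed
  then show ?thesis
    unfolding rough_tail_def by (rule ex_rough_limit_add_lipschitz_iff[OF assms(1,2) L])
qed

text \<open>The affine part is Lipschitz with constant \<open>\<bar>a\<bar>\<close>, so the initial
  value and the slope drop out and only the coefficients matter.\<close>

lemma fs_expansion_rough_iff:
  assumes "1 < p" "0 < T" and x: "fs_expansion T J e a c x"
  shows "x \<in> rough p T \<longleftrightarrow> rough_tail p T J e 0 c"
proof -
  have g: "(0 + \<bar>a\<bar> * 1)-lipschitz_on {0..T} (\<lambda>t. x 0 + a * t)"
    by (intro lipschitz_intros)
  have "rough_tail p T J e 0 c \<longleftrightarrow> (\<exists>y\<in>rough p T. uniform_limit {0..T}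
      (\<lambda>n t. x 0 + a * t + (\<Sum>i<n. \<Sum>j\<in>J i. c i j * e i j t)) y sequentially)"
    unfolding rough_tail_def
    by (rule ex_rough_limit_add_lipschitz_iff[OF assms(1,2) g])
      (simp add: fs_sum_def atLeast0LessThan)
  then show ?thesis
    using ex_rough_limit_iff[OF assms(2) x[unfolded fs_expansion_def]] by simp
qed

lemma rough_tail_cong:
  assumes "\<And>i j. n \<le> i \<Longrightarrow> j \<in> J i \<Longrightarrow> c i j = c' i j"
  shows "rough_tail p T J e n c \<longleftrightarrow> rough_tail p T J e n c'"
proof -
  have "fs_sum J e c {n..<m} = fs_sum J e c' {n..<m}" for m
    unfolding fs_sum_def using assms by (intro ext sum.cong) auto
  then show ?thesis by (simp add: rough_tail_def)
qed

section \<open>Coefficient fields and the zero-one law\<close>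

lemma space_sigma_coeff_field:
  "space (sigma \<Omega> {\<theta> i j -` B \<inter> \<Omega> | i j B. n \<le> i \<and> j \<in> J i \<and> B \<in> sets borel}) = \<Omega>"
  by (rule space_measure_of) auto

lemma sets_sigma_coeff_field:
  "sets (sigma \<Omega> {\<theta> i j -` B \<inter> \<Omega> | i j B. n \<le> i \<and> j \<in> J i \<and> B \<in> sets borel}) = coeff_field \<Omega> J \<theta> n"
  unfolding coeff_field_def by (rule sets_measure_of) auto

lemma rough_tail_in_coeff_field:
  assumes "1 < p" "0 < T" and fs: "faber_schauder T \<pi> J e"
  shows "{\<omega>\<in>\<Omega>. rough_tail p T J e n (\<lambda>i j. \<theta> i j \<omega>)} \<in> coeff_field \<Omega> J \<theta> n"
proof -
  \<comment> \<open>The coefficient field is made into a measurable space in which the coefficients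
    of levels at least n are measurable; these are the only ones in the partial sums below.\<close>
  define N where "N = sigma \<Omega> {\<theta> i j -` B \<inter> \<Omega> | i j B. n \<le> i \<and> j \<in> J i \<and> B \<in> sets borel}"
  have N: "space N = \<Omega>" "sets N = coeff_field \<Omega> J \<theta> n"
    unfolding N_def by (rule space_sigma_coeff_field sets_sigma_coeff_field)+
  have \<theta>: "\<theta> i j \<in> borel_measurable N" if "n \<le> i" "j \<in> J i" for i j
  proof (rule measurableI)
    fix B :: "real set" assume "B \<in> sets borel"
    then show "\<theta> i j -` B \<inter> space N \<in> sets N"
      unfolding N coeff_field_def using that by (intro sigma_sets.Basic) blast
  qed simp
  have "{\<omega>\<in>space N. \<exists>y\<in>rough p T.
      uniform_limit {0..T} (\<lambda>m. fs_sum J e (\<lambda>i j. \<theta> i j \<omega>) {n..<m}) y sequentially} \<in> sets N"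
  proof (rule sets_Collect_uniform_limit_rough)
    show "(\<lambda>\<omega>. fs_sum J e (\<lambda>i j. \<theta> i j \<omega>) {n..<m} t) \<in> borel_measurable N" for m t
      unfolding fs_sum_def by (intro borel_measurable_sum borel_measurable_times \<theta>) auto
    show "continuous_on {0..T} (fs_sum J e (\<lambda>i j. \<theta> i j \<omega>) {n..<m})" for m \<omega>
      by (metis fs_sum_lipschitz[OF fs] lipschitz_on_continuous_on)
  qed (use assms in auto)
  then show ?thesis unfolding N rough_tail_def .
qed

lemma coeff_field_subset:
  assumes "\<And>i j. n \<le> i \<Longrightarrow> j \<in> J i \<Longrightarrow> \<theta> i j \<in> borel_measurable M"
  shows "coeff_field (space M) J \<theta> n \<subseteq> sets M"
  unfolding coeff_field_def using assms by (intro sets.sigma_sets_subset) (auto intro: measurable_sets)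

text \<open>Kolmogorov's law is applied to the sigma-fields \<open>A i\<close> generated by whole
  level vectors. Single coefficients are coordinates of these vectors, so the given tail field lies
  in the tail field of A.\<close>

lemma (in prob_space) tail_field_0_1_law:
  assumes indep: "indep_vars (\<lambda>i. Pi\<^sub>M (J i) (\<lambda>_. borel)) (\<lambda>i \<omega>. \<lambda>j\<in>J i. \<theta> i j \<omega>) UNIV"
    and E: "E \<in> tail_field (space M) J \<theta>"
  shows "prob E = 0 \<or> prob E = 1"
proof -
  define A where "A i = sigma_sets (space M)
    {(\<lambda>\<omega>. \<lambda>j\<in>J i. \<theta> i j \<omega>) -` B \<inter> space M | B. B \<in> sets (Pi\<^sub>M (J i) (\<lambda>_. borel :: real measure))}" for i
  have "coeff_field (space M) J \<theta> n \<subseteq> sigma_sets (space M) (\<Union> (A ` {n..}))" for n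
    unfolding coeff_field_def
  proof (rule sigma_sets_mono, clarify)
    fix i j and B :: "real set" assume ij: "n \<le> i" "j \<in> J i" "B \<in> sets borel"
    define C where "C = (\<lambda>f. f j) -` B \<inter> space (Pi\<^sub>M (J i) (\<lambda>_. borel :: real measure))"
    have "C \<in> sets (Pi\<^sub>M (J i) (\<lambda>_. borel))"
      unfolding C_def using ij by (intro measurable_sets[OF measurable_component_singleton]) auto
    moreover have "\<theta> i j -` B \<inter> space M = (\<lambda>\<omega>. \<lambda>j\<in>J i. \<theta> i j \<omega>) -` C \<inter> space M"
      using ij by (auto simp: C_def space_PiM)
    ultimately have "\<theta> i j -` B \<inter> space M \<in> A i"
      unfolding A_def by (intro sigma_sets.Basic) blast
    then show "\<theta> i j -` B \<inter> space M \<in> sigma_sets (space M) (\<Union> (A ` {n..}))"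
      using ij by (intro sigma_sets.Basic) auto
  qed
  \<comment> \<open>\<open>tail_field\<close> intersects from index 1 on, \<open>tail_events\<close>
    from 0 on; monotonicity in n supplies index 0.\<close>
  moreover have "coeff_field (space M) J \<theta> (Suc n) \<subseteq> coeff_field (space M) J \<theta> n" for n
    unfolding coeff_field_def by (intro sigma_sets_mono') (blast dest: Suc_leD)
  moreover have "E \<in> coeff_field (space M) J \<theta> (Suc n)" for n
    using E by (simp add: tail_field_def)
  ultimately have "E \<in> sigma_sets (space M) (\<Union> (A ` {n..}))" for n
    by blast
  then have "E \<in> tail_events A" by (simp add: tail_events_def)
  moreover have "indep_sets A UNIV"
    using indep unfolding indep_vars_def A_def by blast
  moreover have "sigma_algebra (space M) (A i)" for i
    unfolding A_def by (rule sigma_algebra_sigma_sets) auto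
  ultimately show ?thesis by (intro kolmogorov_0_1_law) auto
qed

section \<open>The tail event and its probability\<close>

theorem proposition4p4:
  fixes M :: "'w measure"
    and p T :: real
    and \<pi> :: "nat \<Rightarrow> real set"
    and J :: "nat \<Rightarrow> 'j set"
    and e :: "nat \<Rightarrow> 'j \<Rightarrow> real \<Rightarrow> real"
    and a :: "'w \<Rightarrow> real"
    and \<theta> :: "nat \<Rightarrow> 'j \<Rightarrow> 'w \<Rightarrow> real"
    and X :: "'w \<Rightarrow> real \<Rightarrow> real"
  assumes "prob_space M"
    and "p > 1"
    and "T > 0"
    and "finitely_refining T \<pi>"
    and "\<And>i. finite (J i)"
    and "faber_schauder T \<pi> J e"
    and "(\<lambda>\<omega>. X \<omega> 0) \<in> borel_measurable M"
    and "a \<in> borel_measurable M"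
    and "\<And>i j. j \<in> J i \<Longrightarrow> \<theta> i j \<in> borel_measurable M"
    and "AE \<omega> in M. fs_expansion T J e (a \<omega>) (\<lambda>i j. \<theta> i j \<omega>) (X \<omega>)"
  shows "{\<omega> \<in> space M. X \<omega> \<in> rough p T} \<in> sets (completion M) \<and>
    (\<exists>E\<in>tail_field (space M) J \<theta>. AE \<omega> in M. X \<omega> \<in> rough p T \<longleftrightarrow> \<omega> \<in> E) \<and>
    (AE \<omega> in M. \<forall>\<theta>' x'.
        finite {i. \<exists>j\<in>J i. \<theta>' i j \<noteq> \<theta> i j \<omega>} \<longrightarrow> x' 0 = X \<omega> 0 \<longrightarrow>
        fs_expansion T J e (a \<omega>) \<theta>' x' \<longrightarrow>
        (x' \<in> rough p T \<longleftrightarrow> X \<omega> \<in> rough p T)) \<and>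
    (prob_space.indep_vars M (\<lambda>i. Pi\<^sub>M (J i) (\<lambda>_. borel)) (\<lambda>i \<omega>. \<lambda>j\<in>J i. \<theta> i j \<omega>) UNIV \<longrightarrow>
        measure (completion M) {\<omega> \<in> space M. X \<omega> \<in> rough p T} \<in> {0, 1})"
proof -
  interpret prob_space M by (rule assms(1))
  note fs = \<open>faber_schauder T \<pi> J e\<close>
  let ?X = "{\<omega> \<in> space M. X \<omega> \<in> rough p T}"
  \<comment> \<open>Defined through the whole series, E equals for every n the event that the series
    from level n on is rough, and so lies in every coefficient field.\<close>
  define E where "E = {\<omega> \<in> space M. rough_tail p T J e 0 (\<lambda>i j. \<theta> i j \<omega>)}"
  have E_coeff: "E \<in> coeff_field (space M) J \<theta> n" for n
    using rough_tail_in_coeff_field[OF assms(2,3) fs, of "space M" n \<theta>]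
    unfolding E_def rough_tail_iff[OF assms(2,3) fs, of n] .
  then have E_tail: "E \<in> tail_field (space M) J \<theta>" by (simp add: tail_field_def)
  have "coeff_field (space M) J \<theta> 0 \<subseteq> sets M"
    by (rule coeff_field_subset) (rule assms(9))
  then have E_sets: "E \<in> sets M" using E_coeff by blast
  have AE_E: "AE \<omega> in M. X \<omega> \<in> rough p T \<longleftrightarrow> \<omega> \<in> E"
    using assms(10) AE_space by eventually_elim (simp add: E_def fs_expansion_rough_iff[OF assms(2,3)])
  then have "AE \<omega> in M. \<omega> \<in> E \<longleftrightarrow> \<omega> \<in> ?X"
    using AE_space by eventually_elim auto
  then have AE_X: "AE \<omega> in completion M. \<omega> \<in> E \<longleftrightarrow> \<omega> \<in> ?X" by (rule AE_completion)
  \<comment> \<open>X is tied to its expansion only almost surely, so its event is compared with E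
    up to a null set, which yields measurability in the completion.\<close>
  have X_sets: "?X \<in> sets (completion M)"
    using E_sets by (intro completion.in_sets_AE[OF AE_X]) auto
  moreover have "AE \<omega> in M. \<forall>\<theta>' x'.
        finite {i. \<exists>j\<in>J i. \<theta>' i j \<noteq> \<theta> i j \<omega>} \<longrightarrow> x' 0 = X \<omega> 0 \<longrightarrow>
        fs_expansion T J e (a \<omega>) \<theta>' x' \<longrightarrow>
        (x' \<in> rough p T \<longleftrightarrow> X \<omega> \<in> rough p T)"
    using assms(10)
  proof (eventually_elim, intro allI impI)
    fix \<omega> \<theta>' x'
    assume X: "fs_expansion T J e (a \<omega>) (\<lambda>i j. \<theta> i j \<omega>) (X \<omega>)"
      and fin: "finite {i. \<exists>j\<in>J i. \<theta>' i j \<noteq> \<theta> i j \<omega>}"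
      and x': "fs_expansion T J e (a \<omega>) \<theta>' x'"
    \<comment> \<open>From a level n beyond all changed ones the coefficient families coincide, and
      roughness is decided there.\<close>
    obtain n where "\<forall>i\<in>{i. \<exists>j\<in>J i. \<theta>' i j \<noteq> \<theta> i j \<omega>}. i < n"
      using fin unfolding finite_nat_set_iff_bounded by blast
    then have "rough_tail p T J e n \<theta>' \<longleftrightarrow> rough_tail p T J e n (\<lambda>i j. \<theta> i j \<omega>)"
      by (intro rough_tail_cong) (auto simp: not_less[symmetric])
    then show "x' \<in> rough p T \<longleftrightarrow> X \<omega> \<in> rough p T"
      unfolding rough_tail_iff[OF assms(2,3) fs, of n]
      using fs_expansion_rough_iff[OF assms(2,3) X] fs_expansion_rough_iff[OF assms(2,3) x'] by simp
  qed
  moreover have "measure (completion M) ?X \<in> {0, 1}"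
    if "indep_vars (\<lambda>i. Pi\<^sub>M (J i) (\<lambda>_. borel)) (\<lambda>i \<omega>. \<lambda>j\<in>J i. \<theta> i j \<omega>) UNIV"
  proof -
    have "measure (completion M) E = measure (completion M) ?X"
      using AE_X X_sets E_sets by (intro measure_eq_AE) auto
    then show ?thesis using tail_field_0_1_law[OF that E_tail] E_sets by simp
  qed
  ultimately show ?thesis using AE_E E_tail by blast
qed

end
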